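(* Let $H$ be a graph with binary chromatic number $\chi_B(H)=k+1$. Let $c_{\min}$ be the least integer $c\in\{0,\dots,k\}$ such that $V(H)$ cannot be partitioned into $c$ cliques and $k-c$ cocliques, and let $c_{\max}$ be the greatest such integer. If $c_{\min}\le k/2\le c_{\max}$, then $$\mathrm{Dist}(n,\mathrm{Forb}(n,H))\le \frac{1}{2k}\binom{n}{2}.$$ Otherwise, letting $c_0$ be the one of $c_{\min},c_{\max}$ that is closest to $k/2$, $$\mathrm{Dist}(n,\mathrm{Forb}(n,H))\le \left(\frac{1}{1+2\sqrt{\frac{c_0}{k}\left(1-\frac{c_0}{k}\right)}}\right)\frac{1}{k}\binom{n}{2}\le \frac{1}{k}\binom{n}{2}.$$
   Context: An edge-operation on a graph is the deletion of an existing edge or the addition of a non-existing edge. For graphs $G,G'$ on the same number of vertices, $\mathrm{Dist}(G,G')=\min\{|E(G)\,\Delta\, E(G'')| : G''\cong G',\ V(G'')=V(G)\}$. For a family $\mathcal H$ of $n$-vertex graphs, $\mathrm{Dist}(G,\mathcal H)=\min_{H'\in\mathcal H}\mathrm{Dist}(G,H')$ and $\mathrm{Dist}(n,\mathcal H)=\max\{\mathrm{Dist}(G,\mathcal H): |V(G)|=n\}$. $\mathrm{Forb}(n,H)$ is the set of all graphs on $n$ vertices with no induced subgraph isomorphic to $H$. A clique is a vertex set inducing a complete graph, a coclique a vertex set inducing an edgeless graph. The binary chromatic number $\chi_B(G)$ is the least integer $k+1$ such that for every $c\in\{0,\dots,k+1\}$ there is a partition of $V(G)$ into $c$ cliques and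 $k+1-c$ cocliques (parts may be empty). *)

theory Defs
  imports Complex_Main "HOL-Library.Ramsey" "HOL-Library.Disjoint_Sets"
begin

datatype 'a graph = Graph (verts: "'a set") (edges: "'a set set")

definition sgraph :: "'a graph \<Rightarrow> bool" where
  "sgraph G \<longleftrightarrow> finite (verts G) \<and> edges G \<subseteq> [verts G]\<^bsup>2\<^esup>"

definition graph_iso :: "'a graph \<Rightarrow> 'b graph \<Rightarrow> bool" (infix "\<simeq>\<^sub>g" 50) where
  "G \<simeq>\<^sub>g G' \<longleftrightarrow> (\<exists>f. bij_betw f (verts G) (verts G') \<and>
     (\<forall>u\<in>verts G. \<forall>v\<in>verts G. {u, v} \<in> edges G \<longleftrightarrow> {f u, f v} \<in> edges G'))"

definition induced_subgraph :: "'a graph \<Rightarrow> 'a set \<Rightarrow> 'a graph" where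
  "induced_subgraph G S = Graph S {e \<in> edges G. e \<subseteq> S}"

text \<open>The graphs on \<open>n\<close> vertices are taken with vertices in \<^typ>\<open>nat\<close> (any vertex set of
  cardinality \<open>n\<close>), which represents every isomorphism type; \<open>H\<close> may live on any type.\<close>

definition graphs_on :: "nat \<Rightarrow> nat graph set" where
  "graphs_on n = {G. sgraph G \<and> card (verts G) = n}"

definition Forb :: "nat \<Rightarrow> 'a graph \<Rightarrow> nat graph set" where
  "Forb n H = {G \<in> graphs_on n. \<not> (\<exists>S \<subseteq> verts G. induced_subgraph G S \<simeq>\<^sub>g H)}"

text \<open>The minima and maxima below are \<^const>\<open>Min\<close> and \<^const>\<open>Max\<close>, hence meaningful only for
  nonempty finite sets of values; the lemmas \<open>dist_graph_set\<close>, \<open>dist_family_set\<close> and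
  \<open>dist_max_set\<close> show that this is the case for a nonempty family of graphs on \<open>n\<close> vertices.\<close>

definition dist_graph :: "'a graph \<Rightarrow> 'b graph \<Rightarrow> nat" where
  "dist_graph G G' = Min {card (sym_diff (edges G) (edges G'')) | G''.
     sgraph G'' \<and> verts G'' = verts G \<and> G'' \<simeq>\<^sub>g G'}"

definition dist_family :: "'a graph \<Rightarrow> 'b graph set \<Rightarrow> nat" where
  "dist_family G \<H> = Min {dist_graph G H' | H'. H' \<in> \<H>}"

definition dist_max :: "nat \<Rightarrow> 'b graph set \<Rightarrow> nat" where
  "dist_max n \<H> = Max {dist_family G \<H> | G. G \<in> graphs_on n}"

text \<open>A partition of the vertex set into \<open>a\<close> cliques (indices below \<open>a\<close>) and \<open>b\<close> cocliques
  (the remaining indices); parts may be empty.\<close>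

definition clique_coclique_partition :: "'a graph \<Rightarrow> nat \<Rightarrow> nat \<Rightarrow> bool" where
  "clique_coclique_partition G a b \<longleftrightarrow> (\<exists>P :: nat \<Rightarrow> 'a set.
     disjoint_family_on P {..<a + b} \<and> (\<Union>i<a + b. P i) = verts G \<and>
     (\<forall>i<a. clique (P i) (edges G)) \<and> (\<forall>i\<in>{a..<a + b}. indep (P i) (edges G)))"

definition binary_chromatic_number :: "'a graph \<Rightarrow> nat" ("\<chi>\<^sub>B") where
  "\<chi>\<^sub>B G = (LEAST m. \<forall>c\<in>{0..m}. clique_coclique_partition G c (m - c))"

definition c_min :: "'a graph \<Rightarrow> nat \<Rightarrow> nat" where
  "c_min H k = Min {c \<in> {0..k}. \<not> clique_coclique_partition H c (k - c)}"

definition c_max :: "'a graph \<Rightarrow> nat \<Rightarrow> nat" where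
  "c_max H k = Max {c \<in> {0..k}. \<not> clique_coclique_partition H c (k - c)}"

lemma c_min_c_max_set:
  assumes "\<chi>\<^sub>B H = k + 1"
  shows "{c \<in> {0..k}. \<not> clique_coclique_partition H c (k - c)} \<noteq> {}"
proof -
  have "\<not> (\<forall>c\<in>{0..k}. clique_coclique_partition H c (k - c))"
    using assms not_less_Least[of k "\<lambda>m. \<forall>c\<in>{0..m}. clique_coclique_partition H c (m - c)"]
    unfolding binary_chromatic_number_def by simp
  then show ?thesis by blast
qed

lemma card_sym_diff_edges_le:
  assumes "sgraph G" "sgraph G''" "verts G'' = verts G"
  shows "card (sym_diff (edges G) (edges G'')) \<le> card (verts G) choose 2"
proof -
  have "sym_diff (edges G) (edges G'') \<subseteq> [verts G]\<^bsup>2\<^esup>"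
    using assms unfolding sgraph_def by auto
  moreover have "finite ([verts G]\<^bsup>2\<^esup>)"
    using assms unfolding sgraph_def by (simp add: finite_imp_finite_nsets)
  moreover have "card ([verts G]\<^bsup>2\<^esup>) = card (verts G) choose 2"
    using assms n_subsets[of "verts G" 2] unfolding sgraph_def nsets_def
    by (metis (mono_tags, lifting) Collect_cong finite_subset)
  ultimately show ?thesis by (metis card_mono)
qed

lemma dist_graph_set:
  fixes G :: "'a graph" and G' :: "'b graph"
  assumes "sgraph G" "sgraph G'" "card (verts G') = card (verts G)"
  defines "D \<equiv> {card (sym_diff (edges G) (edges G'')) | G''.
     sgraph G'' \<and> verts G'' = verts G \<and> G'' \<simeq>\<^sub>g G'}"
  shows "finite D" "D \<noteq> {}"
proof -
  have "D \<subseteq> {..card (verts G) choose 2}"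
    unfolding D_def using card_sym_diff_edges_le[OF assms(1)] by auto
  then show "finite D" by (rule finite_subset) simp
  obtain f where f: "bij_betw f (verts G) (verts G')"
    using assms finite_same_card_bij unfolding sgraph_def by metis
  define X where "X = Graph (verts G) {e \<in> [verts G]\<^bsup>2\<^esup>. f ` e \<in> edges G'}"
  have "sgraph X" using assms unfolding sgraph_def X_def by auto
  moreover have "X \<simeq>\<^sub>g G'"
    unfolding graph_iso_def
  proof (intro exI conjI ballI)
    show "bij_betw f (verts X) (verts G')" using f by (simp add: X_def)
    fix u v assume uv: "u \<in> verts X" "v \<in> verts X"
    show "{u, v} \<in> edges X \<longleftrightarrow> {f u, f v} \<in> edges G'"
    proof (cases "u = v")
      case True
      have "{f v} \<notin> edges G'" using assms(2) unfolding sgraph_def nsets_def by auto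
      with True show ?thesis by (auto simp: X_def nsets_def)
    next
      case False
      with uv show ?thesis by (auto simp: X_def nsets_def)
    qed
  qed
  ultimately show "D \<noteq> {}" unfolding D_def by (force simp: X_def)
qed

lemma dist_graph_le:
  assumes "sgraph G" "sgraph G'" "card (verts G') = card (verts G)"
  shows "dist_graph G G' \<le> card (verts G) choose 2"
  using Min_in[OF dist_graph_set[OF assms]] card_sym_diff_edges_le[OF assms(1)]
  unfolding dist_graph_def by auto

lemma dist_family_set:
  assumes "G \<in> graphs_on n" "\<H> \<subseteq> graphs_on n" "\<H> \<noteq> {}"
  shows "finite {dist_graph G H' | H'. H' \<in> \<H>}" "{dist_graph G H' | H'. H' \<in> \<H>} \<noteq> {}"
proof -
  have "{dist_graph G H' | H'. H' \<in> \<H>} \<subseteq> {..n choose 2}"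
    using assms dist_graph_le[of G] unfolding graphs_on_def by fastforce
  then show "finite {dist_graph G H' | H'. H' \<in> \<H>}" by (rule finite_subset) simp
qed (use assms in auto)

lemma dist_max_set:
  assumes "\<H> \<subseteq> graphs_on n" "\<H> \<noteq> {}"
  shows "finite {dist_family G \<H> | G. G \<in> graphs_on n}"
    "{dist_family G \<H> | G. G \<in> graphs_on n} \<noteq> {}"
proof -
  have "dist_family G \<H> \<le> n choose 2" if "G \<in> graphs_on n" for G
    using Min_in[OF dist_family_set[OF that assms]] that assms dist_graph_le[of G]
    unfolding dist_family_def graphs_on_def by fastforce
  then have "{dist_family G \<H> | G. G \<in> graphs_on n} \<subseteq> {..n choose 2}" by auto
  then show "finite {dist_family G \<H> | G. G \<in> graphs_on n}" by (rule finite_subset) simp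
qed (use assms in auto)

end

theory Submission
  imports Defs
begin

text \<open>Suppose that \<open>H\<close> has no partition into \<open>c\<close> cliques and \<open>k - c\<close> cocliques. Distribute the
  vertices of \<open>G\<close> independently at random into \<open>k\<close> classes and edit \<open>G\<close> so that the first \<open>c\<close>
  classes become cliques and the others cocliques; the result has no induced copy of \<open>H\<close>. If each
  clique class has probability \<open>a\<close>, each coclique class probability \<open>b\<close>, and \<open>G\<close> has density \<open>p\<close>,
  the expected number of edits is \<open>(p (k - c) b\<^sup>2 + (1 - p) c a\<^sup>2) (n choose 2)\<close>. Subject to
  \<open>c a + (k - c) b = 1\<close> this is minimal for \<open>a : b = p : (1 - p)\<close>, where it equals
  \<open>p (1 - p) / (c p + (k - c) (1 - p)) (n choose 2)\<close>. For a fixed \<open>c\<close> the worst density gives the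
  bound with the square root; if \<open>c_min \<le> k / 2 \<le> c_max\<close>, taking \<open>c = c_max\<close> for \<open>p \<ge> 1 / 2\<close>
  and \<open>c = c_min\<close> for \<open>p \<le> 1 / 2\<close> makes the denominator at least \<open>k / 2\<close>.\<close>

section \<open>Averaging and a vertex assignment of small cost\<close>

lemma exists_le_weighted_average:
  fixes w X :: "'i \<Rightarrow> real"
  assumes "finite I" "\<And>i. i \<in> I \<Longrightarrow> w i \<ge> 0" "sum w I = 1"
  shows "\<exists>j\<in>I. X j \<le> (\<Sum>i\<in>I. w i * X i)"
proof (rule ccontr)
  define m where "m = (\<Sum>i\<in>I. w i * X i)"
  assume "\<not> ?thesis"
  then have gt: "X j > m" if "j \<in> I" for j using that unfolding m_def by force
  \<comment> \<open>Weights summing to 1 cannot all vanish; the inequality below is strict at this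
    index.\<close>
  obtain i where i: "i \<in> I" "w i > 0"
    using assms by (metis less_eq_real_def sum.neutral zero_neq_one)
  have "(\<Sum>i\<in>I. w i * m) < (\<Sum>i\<in>I. w i * X i)"
  proof (rule sum_strict_mono_ex1[OF assms(1)])
    show "\<forall>x\<in>I. w x * m \<le> w x * X x" using assms(2) gt by (simp add: less_imp_le mult_left_mono)
    show "\<exists>a\<in>I. w a * m < w a * X a" using i gt by force
  qed
  moreover have "(\<Sum>i\<in>I. w i * m) = m"
    using assms(3) by (simp add: sum_distrib_right[symmetric])
  ultimately show False by (simp add: m_def)
qed

lemma sum_nsets_two_insert:
  fixes g :: "'v set \<Rightarrow> real"
  assumes "finite V" "u \<notin> V"
  shows "(\<Sum>e\<in>[insert u V]\<^bsup>2\<^esup>. g e) = (\<Sum>e\<in>[V]\<^bsup>2\<^esup>. g e) + (\<Sum>v\<in>V. g {u, v})"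
proof -
  have eq: "[insert u V]\<^bsup>2\<^esup> = [V]\<^bsup>2\<^esup> \<union> (\<lambda>v. {u, v}) ` V"
  proof (intro set_eqI iffI)
    fix e assume "e \<in> [insert u V]\<^bsup>2\<^esup>"
    then obtain x y where "e = {x, y}" "x \<noteq> y" "x \<in> insert u V" "y \<in> insert u V"
      unfolding nsets_def card_2_iff by auto
    then show "e \<in> [V]\<^bsup>2\<^esup> \<union> (\<lambda>v. {u, v}) ` V"
      unfolding nsets_def by (auto simp: insert_commute)
  next
    fix e assume "e \<in> [V]\<^bsup>2\<^esup> \<union> (\<lambda>v. {u, v}) ` V"
    then show "e \<in> [insert u V]\<^bsup>2\<^esup>"
      using assms unfolding nsets_def by (auto simp: card_2_iff)
  qed
  have "inj_on (\<lambda>v. {u, v}) V" by (auto simp: inj_on_def doubleton_eq_iff)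
  moreover have "[V]\<^bsup>2\<^esup> \<inter> (\<lambda>v. {u, v}) ` V = {}"
    using assms unfolding nsets_def by auto
  ultimately show ?thesis
    using assms unfolding eq
    by (subst sum.union_disjoint) (auto simp: sum.reindex finite_imp_finite_nsets)
qed

text \<open>Derandomized: the vertices are placed one by one, each without increasing the conditional
  expectation. The linear cost \<open>L\<close> carries the interaction with the vertices already placed.\<close>

lemma exists_assignment_le_expectation:
  fixes w :: "'i \<Rightarrow> real" and C :: "'v set \<Rightarrow> 'i \<Rightarrow> real"
  assumes "finite I" "\<And>i. i \<in> I \<Longrightarrow> w i \<ge> 0" "sum w I = 1" "finite V"
  shows "\<exists>f. f ` V \<subseteq> I \<and>
    (\<Sum>e\<in>[V]\<^bsup>2\<^esup>. \<Sum>i\<in>I. if \<forall>v\<in>e. f v = i then C e i else 0) + (\<Sum>v\<in>V. L v (f v))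
     \<le> (\<Sum>e\<in>[V]\<^bsup>2\<^esup>. \<Sum>i\<in>I. w i ^ 2 * C e i) + (\<Sum>v\<in>V. \<Sum>i\<in>I. w i * L v i)"
  using assms(4)
proof (induction V arbitrary: L rule: finite_induct)
  case empty
  have "[{} :: 'v set]\<^bsup>2\<^esup> = {}" by (auto simp: nsets_def)
  then show ?case by simp
next
  case (insert u V)
  define Q where "Q = (\<Sum>e\<in>[V]\<^bsup>2\<^esup>. \<Sum>i\<in>I. w i ^ 2 * C e i) + (\<Sum>v\<in>V. \<Sum>i\<in>I. w i * L v i)"
  \<comment> \<open>The expected cost caused by placing \<open>u\<close> in class \<open>j\<close>:
    each \<open>v\<close> still to be placed joins it there with probability
    \<open>w j\<close>.\<close>
  define X where "X j = L u j + (\<Sum>v\<in>V. w j * C {u, v} j)" for j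
  obtain j where j: "j \<in> I" "X j \<le> (\<Sum>i\<in>I. w i * X i)"
    using exists_le_weighted_average[OF assms(1-3)] by blast
  \<comment> \<open>With \<open>u\<close> fixed in class \<open>j\<close>, the cost of the pair
    \<open>{u, v}\<close> depends on the class of \<open>v\<close> alone and becomes linear. This is
    why the induction generalizes over \<open>L\<close>.\<close>
  define L' where "L' v i = L v i + (if i = j then C {u, v} j else 0)" for v i
  obtain f where f: "f ` V \<subseteq> I"
    "(\<Sum>e\<in>[V]\<^bsup>2\<^esup>. \<Sum>i\<in>I. if \<forall>v\<in>e. f v = i then C e i else 0) + (\<Sum>v\<in>V. L' v (f v))
     \<le> (\<Sum>e\<in>[V]\<^bsup>2\<^esup>. \<Sum>i\<in>I. w i ^ 2 * C e i) + (\<Sum>v\<in>V. \<Sum>i\<in>I. w i * L' v i)"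
    using insert.IH[of L'] by blast
  define f' where "f' = f(u := j)"
  have f'V: "f' v = f v" if "v \<in> V" for v using that insert.hyps by (auto simp: f'_def)
  have "(\<Sum>i\<in>I. w i * L' v i) = (\<Sum>i\<in>I. w i * L v i) + w j * C {u, v} j" for v
    using j(1) assms(1)
    by (simp add: L'_def distrib_left sum.distrib if_distrib[of "\<lambda>x. _ * x"] cong: if_cong)
  then have L'_avg: "(\<Sum>v\<in>V. \<Sum>i\<in>I. w i * L' v i)
      = (\<Sum>v\<in>V. \<Sum>i\<in>I. w i * L v i) + (\<Sum>v\<in>V. w j * C {u, v} j)"
    by (simp add: sum.distrib)
  have old: "(\<Sum>e\<in>[V]\<^bsup>2\<^esup>. \<Sum>i\<in>I. if \<forall>v\<in>e. f' v = i then C e i else 0)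
      = (\<Sum>e\<in>[V]\<^bsup>2\<^esup>. \<Sum>i\<in>I. if \<forall>v\<in>e. f v = i then C e i else 0)"
  proof (intro sum.cong refl)
    fix e i assume "e \<in> [V]\<^bsup>2\<^esup>"
    then have "(\<forall>v\<in>e. f' v = i) \<longleftrightarrow> (\<forall>v\<in>e. f v = i)"
      using f'V unfolding nsets_def by fastforce
    then show "(if \<forall>v\<in>e. f' v = i then C e i else 0) = (if \<forall>v\<in>e. f v = i then C e i else 0)"
      by simp
  qed
  have new: "(\<Sum>i\<in>I. if \<forall>x\<in>{u, v}. f' x = i then C {u, v} i else 0)
      = (if f v = j then C {u, v} j else 0)" if "v \<in> V" for v
  proof -
    have "(\<Sum>i\<in>I. if \<forall>x\<in>{u, v}. f' x = i then C {u, v} i else 0)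
        = (\<Sum>i\<in>I. if i = j then (if f v = j then C {u, v} j else 0) else 0)"
      using that f'V by (intro sum.cong) (auto simp: f'_def)
    then show ?thesis using j(1) assms(1) by simp
  qed
  have "(\<Sum>e\<in>[insert u V]\<^bsup>2\<^esup>. \<Sum>i\<in>I. if \<forall>v\<in>e. f' v = i then C e i else 0)
        + (\<Sum>v\<in>insert u V. L v (f' v))
      = (\<Sum>e\<in>[V]\<^bsup>2\<^esup>. \<Sum>i\<in>I. if \<forall>v\<in>e. f v = i then C e i else 0)
        + (\<Sum>v\<in>V. if f v = j then C {u, v} j else 0) + L u j + (\<Sum>v\<in>V. L v (f v))"
    unfolding sum_nsets_two_insert[OF insert.hyps] old
    using insert.hyps new f'V by (simp add: f'_def cong: sum.cong)
  also have "\<dots> = (\<Sum>e\<in>[V]\<^bsup>2\<^esup>. \<Sum>i\<in>I. if \<forall>v\<in>e. f v = i then C e i else 0)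
        + (\<Sum>v\<in>V. L' v (f v)) + L u j"
    by (simp add: L'_def sum.distrib)
  also have "\<dots> \<le> Q + X j"
    using f(2) L'_avg by (simp add: Q_def X_def)
  also have "\<dots> \<le> Q + (\<Sum>i\<in>I. w i * X i)" using j(2) by simp
  \<comment> \<open>One factor \<open>w i\<close> comes from averaging over the class of
    \<open>u\<close>, the other from that of \<open>v\<close>; together they give the
    square.\<close>
  also have "(\<Sum>i\<in>I. w i * X i)
      = (\<Sum>i\<in>I. w i * L u i) + (\<Sum>v\<in>V. \<Sum>i\<in>I. w i ^ 2 * C {u, v} i)"
    by (subst sum.swap)
      (simp add: X_def distrib_left sum.distrib sum_distrib_left power2_eq_square mult.assoc)
  also have "Q + \<dots> = (\<Sum>e\<in>[insert u V]\<^bsup>2\<^esup>. \<Sum>i\<in>I. w i ^ 2 * C e i)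
      + (\<Sum>v\<in>insert u V. \<Sum>i\<in>I. w i * L v i)"
    unfolding sum_nsets_two_insert[OF insert.hyps] using insert.hyps by (simp add: Q_def)
  finally have "(\<Sum>e\<in>[insert u V]\<^bsup>2\<^esup>. \<Sum>i\<in>I. if \<forall>v\<in>e. f' v = i then C e i else 0)
        + (\<Sum>v\<in>insert u V. L v (f' v)) \<le> (\<Sum>e\<in>[insert u V]\<^bsup>2\<^esup>. \<Sum>i\<in>I. w i ^ 2 * C e i)
      + (\<Sum>v\<in>insert u V. \<Sum>i\<in>I. w i * L v i)" .
  moreover have "f' ` insert u V \<subseteq> I" using f(1) j(1) f'V by (auto simp: f'_def)
  ultimately show ?case by blast
qed

section \<open>Editing a graph into one without induced copies of \<open>H\<close>\<close>

text \<open>Pairs between different classes stay untouched, so the edits are counted by a sum over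
  monochromatic pairs, the form treated by \<open>exists_assignment_le_expectation\<close>.\<close>

definition recolour :: "'a graph \<Rightarrow> ('a \<Rightarrow> nat) \<Rightarrow> nat \<Rightarrow> 'a graph" where
  "recolour G f c = Graph (verts G)
     {e \<in> [verts G]\<^bsup>2\<^esup>. if \<exists>i. \<forall>v\<in>e. f v = i then \<exists>i<c. \<forall>v\<in>e. f v = i else e \<in> edges G}"

text \<open>An induced copy of \<open>H\<close> meets the first \<open>c\<close> classes in cliques
  and the others in cocliques; carried over by the isomorphism, these traces would be the excluded
  partition of \<open>H\<close>.\<close>

lemma recolour_in_Forb:
  assumes "G \<in> graphs_on n" "f ` verts G \<subseteq> {..<k}" "c \<le> k"
    and no_part: "\<not> clique_coclique_partition H c (k - c)"
  shows "recolour G f c \<in> Forb n H"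
proof -
  let ?R = "recolour G f c"
  have "\<not> induced_subgraph ?R S \<simeq>\<^sub>g H" if S: "S \<subseteq> verts G" for S
  proof
    assume "induced_subgraph ?R S \<simeq>\<^sub>g H"
    then obtain \<phi> where bij: "bij_betw \<phi> S (verts H)" and
      iso: "\<And>u v. u \<in> S \<Longrightarrow> v \<in> S \<Longrightarrow> {u, v} \<in> edges ?R \<longleftrightarrow> {\<phi> u, \<phi> v} \<in> edges H"
      unfolding graph_iso_def induced_subgraph_def by auto
    define P where "P i = \<phi> ` {v \<in> S. f v = i}" for i
    have inj: "inj_on \<phi> S" using bij by (simp add: bij_betw_def)
    have same: "{\<phi> u, \<phi> v} \<in> edges H \<longleftrightarrow> f u < c"
      if "u \<in> S" "v \<in> S" "\<phi> u \<noteq> \<phi> v" "f u = f v" for u v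
    proof -
      have "u \<noteq> v" using that by auto
      then show ?thesis using iso[OF that(1,2)] that S by (auto simp: recolour_def nsets_def)
    qed
    have "disjoint_family_on P {..<c + (k - c)}"
      using inj unfolding disjoint_family_on_def P_def by (auto dest: inj_onD)
    moreover have "(\<Union>i<c + (k - c). P i) = verts H"
    proof -
      have "(\<Union>i<k. P i) = \<phi> ` S" using S assms(2) unfolding P_def by auto
      then show ?thesis using bij assms(3) by (simp add: bij_betw_def)
    qed
    moreover have "\<forall>i<c. clique (P i) (edges H)"
      using same by (auto simp: clique_def P_def)
    moreover have "\<forall>i\<in>{c..<c + (k - c)}. indep (P i) (edges H)"
      using same by (auto simp: indep_def P_def)
    ultimately show False
      using no_part unfolding clique_coclique_partition_def by blast
  qed
  moreover have "?R \<in> graphs_on n"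
    using assms(1) by (auto simp: graphs_on_def sgraph_def recolour_def)
  ultimately show ?thesis unfolding Forb_def by (auto simp: recolour_def)
qed

text \<open>With the identity as isomorphism, \<open>G'\<close> is a candidate in both
  minima.\<close>

lemma dist_family_Forb_le:
  fixes G :: "nat graph"
  assumes "G \<in> graphs_on n" "G' \<in> Forb n H" "verts G' = verts G"
  shows "dist_family G (Forb n H) \<le> card (sym_diff (edges G) (edges G'))"
proof -
  have G': "G' \<in> graphs_on n" and sub: "Forb n H \<subseteq> graphs_on n"
    using assms(2) unfolding Forb_def by auto
  then have sg: "sgraph G" "sgraph G'" "card (verts G') = card (verts G)"
    using assms unfolding graphs_on_def by auto
  have "G' \<simeq>\<^sub>g G'" unfolding graph_iso_def by (rule exI[of _ id]) auto
  then have "dist_graph G G' \<le> card (sym_diff (edges G) (edges G'))"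
    unfolding dist_graph_def using dist_graph_set(1)[OF sg] sg assms(3)
    by (intro Min_le) auto
  moreover have "dist_family G (Forb n H) \<le> dist_graph G G'"
    unfolding dist_family_def using dist_family_set(1)[OF assms(1) sub] assms(2)
    by (intro Min_le) auto
  ultimately show ?thesis by simp
qed

section \<open>Bounds for a graph of given edge density\<close>

lemma dist_family_le_weights:
  fixes G :: "nat graph" and a b p :: real
  assumes G: "G \<in> graphs_on n" and "c \<le> k"
    and no_part: "\<not> clique_coclique_partition H c (k - c)"
    and ab: "a \<ge> 0" "b \<ge> 0" "real c * a + (real k - real c) * b = 1"
    and p: "real (card (edges G)) = p * real (n choose 2)"
  shows "real (dist_family G (Forb n H))
    \<le> (p * ((real k - real c) * b\<^sup>2) + (1 - p) * (real c * a\<^sup>2)) * real (n choose 2)"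
proof -
  let ?V = "verts G" and ?E = "edges G"
  define w where "w i = (if i < c then a else b)" for i
  \<comment> \<open>Equals 1 exactly when \<open>e\<close> must be edited if both its ends lie in
    class \<open>i\<close>.\<close>
  define C :: "nat set \<Rightarrow> nat \<Rightarrow> real" where "C e i = of_bool ((i < c) \<noteq> (e \<in> ?E))" for e i
  have V: "finite ?V" "card ?V = n" "?E \<subseteq> [?V]\<^bsup>2\<^esup>"
    using G unfolding graphs_on_def sgraph_def by auto
  have fin: "finite ([?V]\<^bsup>2\<^esup>)" using V(1) by (rule finite_imp_finite_nsets)
  have card_pairs: "card ([?V]\<^bsup>2\<^esup>) = n choose 2" using V card_nsets by metis
  have split: "(\<Sum>i<k. if i < c then x else y) = real c * x + (real k - real c) * y"
    for x y :: real
  proof -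
    have "{..<k} \<inter> {i. i < c} = {..<c}" "{..<k} \<inter> - {i. i < c} = {c..<k}"
      using \<open>c \<le> k\<close> by auto
    then show ?thesis using \<open>c \<le> k\<close> by (simp add: sum.If_cases of_nat_diff)
  qed
  \<comment> \<open>No vertex has been placed yet, so the linear cost is 0.\<close>
  have "\<exists>f. f ` ?V \<subseteq> {..<k} \<and>
    (\<Sum>e\<in>[?V]\<^bsup>2\<^esup>. \<Sum>i<k. if \<forall>v\<in>e. f v = i then C e i else 0) + (\<Sum>v\<in>?V. 0)
     \<le> (\<Sum>e\<in>[?V]\<^bsup>2\<^esup>. \<Sum>i<k. w i ^ 2 * C e i) + (\<Sum>v\<in>?V. \<Sum>i<k. w i * 0)"
    by (rule exists_assignment_le_expectation) (use ab split[of a b] V in \<open>auto simp: w_def\<close>)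
  then obtain f where f: "f ` ?V \<subseteq> {..<k}"
    "(\<Sum>e\<in>[?V]\<^bsup>2\<^esup>. \<Sum>i<k. if \<forall>v\<in>e. f v = i then C e i else 0)
     \<le> (\<Sum>e\<in>[?V]\<^bsup>2\<^esup>. \<Sum>i<k. w i ^ 2 * C e i)"
    by auto
  let ?R = "recolour G f c"
  have "sym_diff ?E (edges ?R) \<subseteq> [?V]\<^bsup>2\<^esup>" using V(3) by (auto simp: recolour_def)
  then have "real (card (sym_diff ?E (edges ?R)))
      = (\<Sum>e\<in>[?V]\<^bsup>2\<^esup>. of_bool (e \<in> sym_diff ?E (edges ?R)))"
    using fin by (simp only: of_bool_def sum.If_cases Collect_mem_eq Int_absorb1) simp
  \<comment> \<open>An edited pair lies within one class and is charged 1 there; no charge is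
    negative.\<close>
  also have "\<dots> \<le> (\<Sum>e\<in>[?V]\<^bsup>2\<^esup>. \<Sum>i<k. if \<forall>v\<in>e. f v = i then C e i else 0)"
  proof (rule sum_mono)
    fix e assume e: "e \<in> [?V]\<^bsup>2\<^esup>"
    show "of_bool (e \<in> sym_diff ?E (edges ?R))
        \<le> (\<Sum>i<k. if \<forall>v\<in>e. f v = i then C e i else 0)"
    proof (cases "e \<in> sym_diff ?E (edges ?R)")
      case True
      then obtain i where i: "\<forall>v\<in>e. f v = i"
        using e by (auto simp: recolour_def split: if_splits)
      obtain v where v: "v \<in> e" "v \<in> ?V" using e by (auto simp: nsets_def card_2_iff)
      then have "i < k" using i f(1) by auto
      have "e \<in> edges ?R \<longleftrightarrow> i < c" using e i v by (auto simp: recolour_def)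
      then have "C e i = 1" using True by (auto simp: C_def)
      moreover have "(if \<forall>v\<in>e. f v = i then C e i else 0)
          \<le> (\<Sum>i<k. if \<forall>v\<in>e. f v = i then C e i else 0)"
        by (rule member_le_sum) (use \<open>i < k\<close> in \<open>auto simp: C_def\<close>)
      ultimately show ?thesis using i True by simp
    next
      case False
      then show ?thesis by (auto simp: C_def intro!: sum_nonneg)
    qed
  qed
  also note f(2)
  also have "(\<Sum>e\<in>[?V]\<^bsup>2\<^esup>. \<Sum>i<k. w i ^ 2 * C e i)
      = (\<Sum>e\<in>[?V]\<^bsup>2\<^esup>. if e \<in> ?E then (real k - real c) * b\<^sup>2 else real c * a\<^sup>2)"
  proof (rule sum.cong[OF refl])
    fix e
    have "(\<Sum>i<k. w i ^ 2 * C e i) = (\<Sum>i<k. if i < c then (if e \<in> ?E then 0 else a\<^sup>2)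
        else (if e \<in> ?E then b\<^sup>2 else 0))"
      by (rule sum.cong) (auto simp: w_def C_def)
    then show "(\<Sum>i<k. w i ^ 2 * C e i)
        = (if e \<in> ?E then (real k - real c) * b\<^sup>2 else real c * a\<^sup>2)"
      unfolding split by simp
  qed
  also have "\<dots> = real (card ?E) * ((real k - real c) * b\<^sup>2)
      + (real (n choose 2) - real (card ?E)) * (real c * a\<^sup>2)"
  proof -
    have "[?V]\<^bsup>2\<^esup> \<inter> ?E = ?E" "[?V]\<^bsup>2\<^esup> \<inter> - ?E = [?V]\<^bsup>2\<^esup> - ?E" using V(3) by auto
    moreover have "real (card ([?V]\<^bsup>2\<^esup> - ?E)) = real (n choose 2) - real (card ?E)"
      using V(3) fin card_pairs card_mono[OF fin V(3)]
      by (simp add: card_Diff_subset finite_subset of_nat_diff)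
    ultimately show ?thesis using fin by (simp add: sum.If_cases)
  qed
  also have "\<dots> = (p * ((real k - real c) * b\<^sup>2) + (1 - p) * (real c * a\<^sup>2)) * real (n choose 2)"
    unfolding p by (simp add: algebra_simps)
  finally have "real (card (sym_diff ?E (edges ?R)))
    \<le> (p * ((real k - real c) * b\<^sup>2) + (1 - p) * (real c * a\<^sup>2)) * real (n choose 2)" .
  moreover have "dist_family G (Forb n H) \<le> card (sym_diff ?E (edges ?R))"
    by (rule dist_family_Forb_le[OF G recolour_in_Forb[OF G f(1) \<open>c \<le> k\<close> no_part]])
      (simp add: recolour_def)
  ultimately show ?thesis by linarith
qed

text \<open>The weights \<open>p / D\<close> and \<open>(1 - p) / D\<close> have the optimal ratio,
  and \<open>D\<close> normalizes them. The cost becomes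
  \<open>p * (1 - p) * D / D\<^sup>2\<close>.\<close>

lemma dist_family_le_density:
  fixes G :: "nat graph" and p :: real
  assumes G: "G \<in> graphs_on n" and "c \<le> k"
    and no_part: "\<not> clique_coclique_partition H c (k - c)"
    and p: "0 \<le> p" "p \<le> 1" "real (card (edges G)) = p * real (n choose 2)"
    and pos: "real c * p + (real k - real c) * (1 - p) > 0"
  shows "real (dist_family G (Forb n H))
    \<le> p * (1 - p) / (real c * p + (real k - real c) * (1 - p)) * real (n choose 2)"
proof -
  define D where "D = real c * p + (real k - real c) * (1 - p)"
  have "D > 0" using pos by (simp add: D_def)
  have "real (dist_family G (Forb n H)) \<le> (p * ((real k - real c) * ((1 - p) / D)\<^sup>2)
      + (1 - p) * (real c * (p / D)\<^sup>2)) * real (n choose 2)"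
  proof (rule dist_family_le_weights[OF G \<open>c \<le> k\<close> no_part _ _ _ p(3)])
    have "real c * (p / D) + (real k - real c) * ((1 - p) / D) = D / D"
      unfolding times_divide_eq_right add_divide_distrib[symmetric] by (simp add: D_def)
    then show "real c * (p / D) + (real k - real c) * ((1 - p) / D) = 1"
      using \<open>D > 0\<close> by simp
  qed (use p \<open>D > 0\<close> in auto)
  also have "p * ((real k - real c) * ((1 - p) / D)\<^sup>2) + (1 - p) * (real c * (p / D)\<^sup>2)
      = p * (1 - p) * D / D\<^sup>2"
    unfolding D_def by (simp add: power_divide add_divide_distrib[symmetric])
      (simp add: algebra_simps power2_eq_square)
  also have "\<dots> = p * (1 - p) / D" using \<open>D > 0\<close> by (simp add: power2_eq_square)
  finally show ?thesis by (simp add: D_def)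
qed

lemma edge_density:
  assumes "G \<in> graphs_on n"
  obtains p :: real where "0 \<le> p" "p \<le> 1" "real (card (edges G)) = p * real (n choose 2)"
proof
  \<comment> \<open>If \<open>n choose 2\<close> is 0, division by zero yields density 0, which fits
    since there are no edges.\<close>
  let ?p = "real (card (edges G)) / real (n choose 2)"
  have V: "finite (verts G)" "card (verts G) = n" "edges G \<subseteq> [verts G]\<^bsup>2\<^esup>"
    using assms unfolding graphs_on_def sgraph_def by auto
  then have le: "card (edges G) \<le> n choose 2"
    by (metis card_mono card_nsets finite_imp_finite_nsets)
  show "0 \<le> ?p" by simp
  show "?p \<le> 1" by (rule divide_le_eq_1[THEN iffD2]) (use le in auto)
  show "real (card (edges G)) = ?p * real (n choose 2)" using le by (cases "n choose 2 = 0") auto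
qed

section \<open>The worst density\<close>

text \<open>With \<open>s\<close> and \<open>t\<close> the square roots of \<open>c\<close> and
  \<open>k - c\<close>, the claimed factor is \<open>1 / (s + t)\<^sup>2\<close>, because
  \<open>(s + t)\<^sup>2\<close> equals \<open>k + 2 * s * t\<close>.\<close>

lemma dist_family_le_sqrt:
  fixes G :: "nat graph"
  assumes G: "G \<in> graphs_on n" and "c \<le> k" "k \<ge> 1"
    and no_part: "\<not> clique_coclique_partition H c (k - c)"
  shows "real (dist_family G (Forb n H))
    \<le> (1 / (1 + 2 * sqrt (real c / real k * (1 - real c / real k))))
        * (1 / real k) * real (n choose 2)"
proof -
  obtain p :: real where p: "0 \<le> p" "p \<le> 1" "real (card (edges G)) = p * real (n choose 2)"
    using edge_density[OF G] .
  define s where "s = sqrt (real c)"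
  define t where "t = sqrt (real k - real c)"
  have st: "s\<^sup>2 = real c" "t\<^sup>2 = real k - real c" "s \<ge> 0" "t \<ge> 0"
    using \<open>c \<le> k\<close> by (auto simp: s_def t_def)
  have k: "real k > 0" using \<open>k \<ge> 1\<close> by simp
  have "sqrt (real c / real k * (1 - real c / real k)) = sqrt ((s * t / real k)\<^sup>2)"
    using k by (simp add: power_divide power_mult_distrib st) (simp add: field_simps power2_eq_square)
  also have "\<dots> = s * t / real k" using st by simp
  finally have "(1 + 2 * sqrt (real c / real k * (1 - real c / real k))) * real k = (s + t)\<^sup>2"
    using k st by (simp add: power2_sum field_simps)
  then have bound: "(1 / (1 + 2 * sqrt (real c / real k * (1 - real c / real k)))) * (1 / real k)
      = 1 / (s + t)\<^sup>2"
    by simp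
  define D where "D = real c * p + (real k - real c) * (1 - p)"
  have "D \<ge> 0" using p \<open>c \<le> k\<close> by (simp add: D_def)
  have pos: "(s + t)\<^sup>2 > 0"
  proof -
    have "(s + t)\<^sup>2 \<ge> s\<^sup>2 + t\<^sup>2" using st by (simp add: power2_sum)
    then show ?thesis using st k by linarith
  qed
  show ?thesis
  proof (cases "D > 0")
    case True
    \<comment> \<open>The gap is a perfect square, vanishing at
      \<open>p = t / (s + t)\<close>.\<close>
    have "p * (1 - p) * (s + t)\<^sup>2 \<le> s\<^sup>2 * p + t\<^sup>2 * (1 - p)"
    proof -
      have "s\<^sup>2 * p + t\<^sup>2 * (1 - p) - p * (1 - p) * (s + t)\<^sup>2 = (s * p - t * (1 - p))\<^sup>2"
        by algebra
      then show ?thesis by (metis diff_ge_0_iff_ge zero_le_power2)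
    qed
    then have "p * (1 - p) / D \<le> 1 / (s + t)\<^sup>2"
      using True pos by (simp add: D_def st field_simps)
    then have "p * (1 - p) / D * real (n choose 2) \<le> 1 / (s + t)\<^sup>2 * real (n choose 2)"
      by (rule mult_right_mono) simp
    with dist_family_le_density[OF G \<open>c \<le> k\<close> no_part p] True show ?thesis
      unfolding bound D_def by linarith
  next
    case False
    \<comment> \<open>Here \<open>c = 0\<close> and \<open>G\<close> is complete, or \<open>c = k\<close> and \<open>G\<close> is edgeless: the optimal weights
      are undefined and equal weights serve instead.\<close>
    then have "D = 0" using \<open>D \<ge> 0\<close> by simp
    then have "real c * p = 0" "(real k - real c) * (1 - p) = 0"
      using p \<open>c \<le> k\<close> by (auto simp: D_def add_nonneg_eq_0_iff)
    then have cases: "c = 0 \<and> p = 1 \<or> c = k \<and> p = 0" using k by auto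
    have "real (dist_family G (Forb n H)) \<le> (p * ((real k - real c) * (1 / real k)\<^sup>2)
      + (1 - p) * (real c * (1 / real k)\<^sup>2)) * real (n choose 2)"
      by (rule dist_family_le_weights[OF G \<open>c \<le> k\<close> no_part _ _ _ p(3)])
        (use k in \<open>auto simp: field_simps\<close>)
    also have "p * ((real k - real c) * (1 / real k)\<^sup>2) + (1 - p) * (real c * (1 / real k)\<^sup>2)
        = 1 / (s + t)\<^sup>2"
    proof -
      have "(s + t)\<^sup>2 = real k" using cases k by (auto simp: s_def t_def)
      then show ?thesis using cases k by (auto simp: power2_eq_square)
    qed
    finally show ?thesis unfolding bound .
  qed
qed

text \<open>The numerator \<open>p * (1 - p)\<close> is at most 1/4, and one of \<open>c\<close>,
  \<open>d\<close> makes the denominator at least \<open>k / 2\<close>.\<close>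

lemma dist_family_le_half:
  fixes G :: "nat graph"
  assumes G: "G \<in> graphs_on n" and "k \<ge> 1"
    and c: "c \<le> k" "real c \<le> real k / 2" "\<not> clique_coclique_partition H c (k - c)"
    and d: "d \<le> k" "real k / 2 \<le> real d" "\<not> clique_coclique_partition H d (k - d)"
  shows "real (dist_family G (Forb n H)) \<le> 1 / (2 * real k) * real (n choose 2)"
proof -
  obtain p :: real where p: "0 \<le> p" "p \<le> 1" "real (card (edges G)) = p * real (n choose 2)"
    using edge_density[OF G] .
  have k: "real k > 0" using \<open>k \<ge> 1\<close> by simp
  \<comment> \<open>The condition \<open>sign\<close> lets \<open>x\<close> lie on the same side of
    \<open>k / 2\<close> as \<open>p\<close> of 1/2, which treats both choices at once.\<close>
  have *: ?thesis if x: "x \<le> k" "\<not> clique_coclique_partition H x (k - x)"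
    and sign: "(real x - real k / 2) * (2 * p - 1) \<ge> 0" for x
  proof -
    define D where "D = real x * p + (real k - real x) * (1 - p)"
    have "D = real k / 2 + (real x - real k / 2) * (2 * p - 1)"
      by (simp add: D_def field_simps)
    then have D: "D \<ge> real k / 2" "D > 0" using sign k by auto
    have "p * (1 - p) \<le> 1 / 4"
      using zero_le_power2[of "2 * p - 1"] by (simp add: power2_eq_square algebra_simps)
    then have "p * (1 - p) / D \<le> (1 / 4) / (real k / 2)"
      using D k by (intro frac_le) auto
    also have "\<dots> = 1 / (2 * real k)" by simp
    finally have "p * (1 - p) / D * real (n choose 2) \<le> 1 / (2 * real k) * real (n choose 2)"
      by (rule mult_right_mono) simp
    with dist_family_le_density[OF G x p] D show ?thesis unfolding D_def by linarith
  qed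
  show ?thesis
  proof (cases "p \<ge> 1 / 2")
    case True
    then show ?thesis using *[OF d(1,3)] d(2) by simp
  next
    case False
    then show ?thesis using *[OF c(1,3)] c(2) by (simp add: mult_nonpos_nonpos)
  qed
qed

section \<open>The maximum over all graphs on \<open>n\<close> vertices\<close>

text \<open>Makes the minima and the maximum in the distances meaningful. The witness is an edgeless
  graph recoloured with all vertices in class 0, which exists as \<open>k \<ge> 1\<close>.\<close>

lemma Forb_nonempty:
  assumes "c \<le> k" "k \<ge> 1" "\<not> clique_coclique_partition H c (k - c)"
  shows "Forb n H \<noteq> {}"
proof -
  have "Graph {..<n} {} \<in> graphs_on n" by (simp add: graphs_on_def sgraph_def)
  from recolour_in_Forb[OF this _ assms(1,3), of "\<lambda>_. 0"] show ?thesis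
    using assms(2) by (auto simp: image_subset_iff)
qed

theorem theorem1p3:
  fixes H :: "'a graph" and k n :: nat
  assumes "sgraph H"
    and "\<chi>\<^sub>B H = k + 1"
    and "k \<ge> 1"
  shows "(real (c_min H k) \<le> real k / 2 \<and> real k / 2 \<le> real (c_max H k) \<longrightarrow>
            real (dist_max n (Forb n H)) \<le> 1 / (2 * real k) * real (n choose 2))
       \<and> (\<not> (real (c_min H k) \<le> real k / 2 \<and> real k / 2 \<le> real (c_max H k)) \<longrightarrow>
            (\<forall>c\<^sub>0. is_arg_min (\<lambda>c. \<bar>real c - real k / 2\<bar>) (\<lambda>c. c \<in> {c_min H k, c_max H k}) c\<^sub>0 \<longrightarrow>
               real (dist_max n (Forb n H))
                 \<le> (1 / (1 + 2 * sqrt (real c\<^sub>0 / real k * (1 - real c\<^sub>0 / real k))))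
                     * (1 / real k) * real (n choose 2)
             \<and> (1 / (1 + 2 * sqrt (real c\<^sub>0 / real k * (1 - real c\<^sub>0 / real k))))
                     * (1 / real k) * real (n choose 2)
                 \<le> 1 / real k * real (n choose 2)))"
proof -
  let ?B = "{c \<in> {0..k}. \<not> clique_coclique_partition H c (k - c)}"
  have "c_min H k \<in> ?B"
    unfolding c_min_def by (rule Min_in) (use c_min_c_max_set[OF assms(2)] in auto)
  moreover have "c_max H k \<in> ?B"
    unfolding c_max_def by (rule Max_in) (use c_min_c_max_set[OF assms(2)] in auto)
  ultimately have c: "c_min H k \<le> k" "\<not> clique_coclique_partition H (c_min H k) (k - c_min H k)"
    and d: "c_max H k \<le> k" "\<not> clique_coclique_partition H (c_max H k) (k - c_max H k)"
    by auto
  have sub: "Forb n H \<subseteq> graphs_on n" unfolding Forb_def by auto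
  \<comment> \<open>The maximum is attained, so the bounds for a single graph apply.\<close>
  obtain G where G: "G \<in> graphs_on n" "dist_max n (Forb n H) = dist_family G (Forb n H)"
    using Max_in[OF dist_max_set[OF sub Forb_nonempty[OF c(1) assms(3) c(2)]]]
    unfolding dist_max_def by auto
  show ?thesis
  proof (intro conjI impI allI)
    assume "real (c_min H k) \<le> real k / 2 \<and> real k / 2 \<le> real (c_max H k)"
    then show "real (dist_max n (Forb n H)) \<le> 1 / (2 * real k) * real (n choose 2)"
      unfolding G(2) using dist_family_le_half[OF G(1) assms(3) c(1) _ c(2) d(1) _ d(2)] by blast
  next
    fix c\<^sub>0
    assume "is_arg_min (\<lambda>c. \<bar>real c - real k / 2\<bar>) (\<lambda>c. c \<in> {c_min H k, c_max H k}) c\<^sub>0"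
    \<comment> \<open>As one of \<open>c_min H k\<close> and \<open>c_max H k\<close>, the minimizer
      inherits the absence of a partition.\<close>
    then have c0: "c\<^sub>0 \<le> k" "\<not> clique_coclique_partition H c\<^sub>0 (k - c\<^sub>0)"
      using c d by (auto simp: is_arg_min_def)
    show "real (dist_max n (Forb n H))
        \<le> (1 / (1 + 2 * sqrt (real c\<^sub>0 / real k * (1 - real c\<^sub>0 / real k))))
            * (1 / real k) * real (n choose 2)"
      unfolding G(2) by (rule dist_family_le_sqrt[OF G(1) c0(1) assms(3) c0(2)])
    define q where "q = sqrt (real c\<^sub>0 / real k * (1 - real c\<^sub>0 / real k))"
    have "q \<ge> 0" using c0(1) assms(3) by (simp add: q_def)
    then have "1 / (1 + 2 * q) \<le> 1" by simp
    then have "1 / (1 + 2 * sqrt (real c\<^sub>0 / real k * (1 - real c\<^sub>0 / real k))) * (1 / real k)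
        \<le> 1 * (1 / real k)"
      unfolding q_def by (rule mult_right_mono) simp
    then have "1 / (1 + 2 * sqrt (real c\<^sub>0 / real k * (1 - real c\<^sub>0 / real k))) * (1 / real k)
        * real (n choose 2) \<le> 1 * (1 / real k) * real (n choose 2)"
      by (rule mult_right_mono) simp
    then show "(1 / (1 + 2 * sqrt (real c\<^sub>0 / real k * (1 - real c\<^sub>0 / real k))))
        * (1 / real k) * real (n choose 2) \<le> 1 / real k * real (n choose 2)"
      by simp
  qed
qed

end
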